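(* Every hat is $e$-positive: for all integers $a,b\ge0$ and $m\ge2$, the chromatic symmetric function of the hat $H_{a,m,b}$ is a nonnegative linear combination of the elementary symmetric functions $e_\lambda$.
   Context: For $n=a+m+b$, the hat $H_{a,m,b}$ is the graph obtained from the path $v_1v_2\cdots v_n$ by adding the edge $v_{a+1}v_{a+m}$ (for $m=2$ this duplicates an existing edge, which does not affect proper colorings). The chromatic symmetric function of a graph $G$ is $X_G=\sum_\kappa\prod_{v\in V(G)}x_{\kappa(v)}$ over proper colorings $\kappa:V(G)\to\{1,2,\dots\}$; a graph is $e$-positive if every coefficient of $X_G$ in the basis $\{e_\lambda\}$ of elementary symmetric functions is nonnegative. *)

theory Defs
  imports Complex_Main "HOL-Library.Multiset" "HOL-Library.FuncSet"
begin

text \<open>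
  A formal power series over the rationals in the variables \<open>x\<^sub>1, x\<^sub>2, \<dots>\<close> is represented by its
  coefficient function. The monomial \<open>x\<^sub>i\<^sub>1 \<cdots> x\<^sub>i\<^sub>k\<close> is the multiset \<open>{#i\<^sub>1, \<dots>, i\<^sub>k#}\<close> of its indices;
  the index 0 is never used.
\<close>

type_synonym series = "nat multiset \<Rightarrow> rat"

definition series_one :: series where
  "series_one M = (if M = {#} then 1 else 0)"

definition series_mult :: "series \<Rightarrow> series \<Rightarrow> series" where
  "series_mult f g M = (\<Sum>A | A \<subseteq># M. f A * g (M - A))"

text \<open>
  A sum of monomials \<open>\<Sum>\<^sub>j x\<^bsup>M j\<^esup>\<close> has as its coefficient at \<open>M\<close> the number of \<open>j\<close> with \<open>M j = M\<close>.
  In \<open>elem_sym k\<close> the summation index is a \<open>k\<close>-subset of \<open>{1, 2, \<dots>}\<close>, in \<open>chromatic_sym\<close> it is a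
  proper colouring.
\<close>

definition elem_sym :: "nat \<Rightarrow> series" where
  "elem_sym k M = of_nat (card {S. S \<subseteq> {1..} \<and> finite S \<and> card S = k \<and> mset_set S = M})"

definition is_partition :: "nat list \<Rightarrow> bool" where
  "is_partition la \<longleftrightarrow> sorted_wrt (\<ge>) la \<and> (\<forall>k\<in>set la. 0 < k)"

definition elem_sym_partition :: "nat list \<Rightarrow> series" where
  "elem_sym_partition la = foldr series_mult (map elem_sym la) series_one"

type_synonym 'v graph = "'v set \<times> 'v set set"

definition proper_colorings :: "'v graph \<Rightarrow> ('v \<Rightarrow> nat) set" where
  "proper_colorings G =
     {\<kappa> \<in> fst G \<rightarrow>\<^sub>E {1..}. \<forall>u v. {u, v} \<in> snd G \<longrightarrow> \<kappa> u \<noteq> \<kappa> v}"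

definition chromatic_sym :: "'v graph \<Rightarrow> series" where
  "chromatic_sym G M =
     of_nat (card {\<kappa> \<in> proper_colorings G. image_mset \<kappa> (mset_set (fst G)) = M})"

definition e_positive_series :: "series \<Rightarrow> bool" where
  "e_positive_series f \<longleftrightarrow>
     (\<exists>(P :: nat list set) (c :: nat list \<Rightarrow> rat).
        finite P \<and> (\<forall>la\<in>P. is_partition la \<and> 0 \<le> c la) \<and>
        f = (\<lambda>M. \<Sum>la\<in>P. c la * elem_sym_partition la M))"

definition e_positive :: "'v graph \<Rightarrow> bool" where
  "e_positive G \<longleftrightarrow> e_positive_series (chromatic_sym G)"

text \<open>
  The path vertex \<open>v\<^sub>i\<close> is the number \<open>i\<close>. Edges form a set, so for \<open>m = 2\<close> the added edge
  coincides with a path edge.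
\<close>

definition hat :: "nat \<Rightarrow> nat \<Rightarrow> nat \<Rightarrow> nat graph" where
  "hat a m b =
     ({1..a + m + b},
      {{i, i + 1} | i. 1 \<le> i \<and> i < a + m + b} \<union> {{a + 1, a + m}})"

end

theory Submission
  imports Defs "HOL-Library.Poly_Mapping"
begin

text \<open>
  Restrict the colours to a finite set \<open>C\<close> and let \<open>e\<^sub>k\<close>, \<open>e\<^sub>k\<^sup>i\<close>, \<open>e\<^sub>k\<^sup>i\<^sup>j\<close> be the elementary symmetric
  polynomials in the variables of \<open>C\<close>, \<open>C - {i}\<close>, \<open>C - {i, j}\<close>. With
  \<open>\<Sum>\<^sub>n d\<^sub>n z\<^sup>n = 1 / (1 - \<Sum>\<^sub>k (k - 1) e\<^sub>k z\<^sup>k)\<close>, which is \<open>e\<close>-positive, the proper colourings of a path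
  with \<open>k\<close> vertices attached to a vertex of colour \<open>i\<close> sum up to \<open>\<Sum>\<^sub>l d\<^bsub>k-l\<^esub> e\<^sub>l\<^sup>i\<close>, and those of a path
  with \<open>k\<close> vertices joining vertices of colours \<open>i \<noteq> j\<close> to \<open>\<Sum>\<^sub>l d\<^bsub>k-l\<^esub> e\<^sub>l\<^sup>i\<^sup>j\<close>. Summing over the colours
  of the ends of the added edge,
  \<open>X = \<Sum>\<^sub>p\<^sub>l\<^sub>q d\<^bsub>a-p\<^esub> d\<^bsub>m-2-l\<^esub> d\<^bsub>b-q\<^esub> Q(l,p,q)\<close>, where
  \<open>Q(l,p,q) = \<Sum>\<^bsub>i\<noteq>j\<^esub> x\<^sub>i x\<^sub>j e\<^sub>l\<^sup>i\<^sup>j e\<^sub>p\<^sup>i e\<^sub>q\<^sup>j\<close>.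

  It remains to see that \<open>Q\<close> is \<open>e\<close>-positive. Let \<open>A(p,q) = \<Sum>\<^sub>i x\<^sub>i e\<^sub>p\<^sup>i e\<^sub>q\<^sup>i\<close>. It is symmetric, and
  \<open>A(p,q) = (p + 1 - q) e\<^bsub>p+1\<^esub> e\<^sub>q + A(p+1,q-1)\<close>, so it is \<open>e\<close>-positive. Similarly
  \<open>Q(l,p,q) - Q(l-1,p+1,q)\<close> is \<open>(p - l) e\<^bsub>p+1\<^esub> A(l,q) + \<Sum>\<^sub>i x\<^sub>i e\<^sub>l\<^sup>i e\<^bsub>p+1\<^esub>\<^sup>i e\<^sub>q\<^sup>i\<close>, and the last sum can
  again be expanded in products of \<open>A\<close> and \<open>e\<close>. Iterating towards \<open>l = 0\<close> or towards \<open>p = 0\<close> gives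
  two expansions of \<open>Q\<close> in products of \<open>A\<close> and \<open>e\<close>; the first has nonnegative coefficients for
  \<open>l \<le> p\<close>, the second for \<open>l > p\<close>.
\<close>

section \<open>Elementary symmetric polynomials of a finite set of variables\<close>

definition esym :: "('i \<Rightarrow> 'a::comm_ring_1) \<Rightarrow> 'i set \<Rightarrow> nat \<Rightarrow> 'a" where
  "esym x B k = (\<Sum>S | S \<subseteq> B \<and> card S = k. prod x S)"

lemma esym_0:
  assumes "finite B"
  shows "esym x B 0 = 1"
proof -
  have "{S. S \<subseteq> B \<and> card S = 0} = {{}}"
    using assms by (auto dest: finite_subset)
  then show ?thesis by (simp add: esym_def)
qed

lemma esym_empty_Suc: "esym x {} (Suc k) = 0"
  unfolding esym_def by (rule sum.neutral) auto

lemma esym_insert: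
  assumes "finite B" "a \<notin> B"
  shows "esym x (insert a B) (Suc k) = esym x B (Suc k) + x a * esym x B k"
proof -
  let ?F = "\<lambda>k. {S. S \<subseteq> B \<and> card S = k}"
  have split: "{S. S \<subseteq> insert a B \<and> card S = Suc k} = ?F (Suc k) \<union> insert a ` ?F k" (is "?L = ?R")
  proof
    show "?L \<subseteq> ?R"
    proof
      fix S assume S: "S \<in> ?L"
      show "S \<in> ?R"
      proof (cases "a \<in> S")
        case True
        then have "S - {a} \<in> ?F k" "S = insert a (S - {a})"
          using S by auto
        then show ?thesis by blast
      qed (use S in auto)
    qed
    show "?R \<subseteq> ?L"
      using assms by (auto intro!: card_insert_disjoint dest: finite_subset)
  qed
  have inj: "inj_on (insert a) (?F k)"
    using assms(2) by (auto simp: inj_on_def)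
  have "esym x (insert a B) (Suc k) = sum (prod x) (?F (Suc k)) + sum (prod x) (insert a ` ?F k)"
    unfolding esym_def split using assms by (intro sum.union_disjoint) auto
  also have "sum (prod x) (insert a ` ?F k) = (\<Sum>S\<in>?F k. x a * prod x S)"
    unfolding sum.reindex[OF inj] comp_def
    using assms by (intro sum.cong refl prod.insert) (auto dest: finite_subset)
  finally show ?thesis by (simp add: esym_def sum_distrib_left)
qed

lemma esym_remove:
  assumes "finite B" "a \<in> B"
  shows "esym x B (Suc k) = esym x (B - {a}) (Suc k) + x a * esym x (B - {a}) k"
  using esym_insert[of "B - {a}" a x k] assms by (simp add: insert_absorb)

text \<open>Each squarefree monomial of degree \<open>k + 1\<close> arises once for every one of its
  variables \<open>x i\<close>.\<close>

lemma sum_esym_remove: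
  assumes "finite B"
  shows "(\<Sum>i\<in>B. x i * esym x (B - {i}) k) = of_nat (Suc k) * esym x B (Suc k)"
  using assms
proof (induction B arbitrary: k rule: finite_induct)
  case empty
  show ?case by (simp add: esym_empty_Suc)
next
  case (insert a B)
  have rem: "insert a B - {i} = insert a (B - {i})" if "i \<in> B" for i
    using that insert.hyps by auto
  have "(\<Sum>i\<in>insert a B. x i * esym x (insert a B - {i}) k)
      = x a * esym x B k + (\<Sum>i\<in>B. x i * esym x (insert a (B - {i})) k)"
    using insert.hyps by (simp add: rem)
  also have "\<dots> = of_nat (Suc k) * esym x (insert a B) (Suc k)"
  proof (cases k)
    case 0
    then show ?thesis
      using insert.IH[of 0] insert.hyps by (simp add: esym_0 esym_insert)
  next
    case (Suc l)
    have "(\<Sum>i\<in>B. x i * esym x (insert a (B - {i})) k)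
        = (\<Sum>i\<in>B. x i * esym x (B - {i}) k) + x a * (\<Sum>i\<in>B. x i * esym x (B - {i}) l)"
      using insert.hyps Suc
      by (simp add: esym_insert sum.distrib sum_distrib_left algebra_simps)
    then show ?thesis
      using insert.hyps Suc by (simp add: insert.IH esym_insert algebra_simps)
  qed
  finally show ?case .
qed

lemma successively_append_Cons:
  "successively P (xs @ y # ys) \<longleftrightarrow> successively P (xs @ [y]) \<and> successively P (y # ys)"
  by (auto simp: successively_append_iff)

section \<open>Symmetric sums over a finite alphabet\<close>

locale alphabet =
  fixes C :: "'i set" and x :: "'i \<Rightarrow> 'a::comm_ring_1"
  assumes finite_C: "finite C"
begin

abbreviation e :: "nat \<Rightarrow> 'a" where
  "e \<equiv> esym x C"

abbreviation e1 :: "'i \<Rightarrow> nat \<Rightarrow> 'a" where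
  "e1 i \<equiv> esym x (C - {i})"

abbreviation e2 :: "'i \<Rightarrow> 'i \<Rightarrow> nat \<Rightarrow> 'a" where
  "e2 i j \<equiv> esym x (C - {i} - {j})"

definition pair_sum :: "nat \<Rightarrow> nat \<Rightarrow> 'a" where
  "pair_sum p q = (\<Sum>i\<in>C. x i * e1 i p * e1 i q)"

definition triple_sum :: "nat \<Rightarrow> nat \<Rightarrow> nat \<Rightarrow> 'a" where
  "triple_sum p q r = (\<Sum>i\<in>C. x i * e1 i p * e1 i q * e1 i r)"

text \<open>This is Q(l, b, c), with \<open>i\<close> and \<open>j\<close> the colours of the two
  ends of the added edge. Summing over \<open>j\<close> outside lets the inner sum over
  \<open>i\<close> be evaluated for fixed \<open>j\<close> as soon as \<open>l\<close> or
  \<open>b\<close> is 0.\<close>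

definition hat_sum :: "nat \<Rightarrow> nat \<Rightarrow> nat \<Rightarrow> 'a" where
  "hat_sum l b c = (\<Sum>j\<in>C. \<Sum>i\<in>C - {j}. x i * x j * e2 j i l * e1 i b * e1 j c)"

lemma e_Suc: "i \<in> C \<Longrightarrow> e (Suc k) = e1 i (Suc k) + x i * e1 i k"
  using esym_remove[OF finite_C] .

lemma e1_Suc: "i \<in> C \<Longrightarrow> e1 i (Suc k) = e (Suc k) - x i * e1 i k"
  by (simp add: e_Suc)

lemma e2_Suc: "j \<in> C - {i} \<Longrightarrow> e2 i j (Suc k) = e1 i (Suc k) - x j * e2 i j k"
  using esym_remove[of "C - {i}" j x k] finite_C by simp

lemma e_0 [simp]: "e 0 = 1" "e1 i 0 = 1" "e2 i j 0 = 1"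
  using finite_C by (simp_all add: esym_0)

lemma sum_e1: "(\<Sum>i\<in>C. x i * e1 i k) = of_nat (Suc k) * e (Suc k)"
  using sum_esym_remove[OF finite_C] .

lemma sum_e2: "(\<Sum>i\<in>C - {j}. x i * e2 j i k) = of_nat (Suc k) * e1 j (Suc k)"
  using sum_esym_remove[of "C - {j}" x k] finite_C by simp

lemma sum_e1_except: "j \<in> C \<Longrightarrow> (\<Sum>i\<in>C - {j}. x i * e1 i k) = of_nat k * e (Suc k) + e1 j (Suc k)"
  using sum_e1[of k] finite_C by (simp add: sum_diff1 e1_Suc algebra_simps)

lemma pair_sum_commute: "pair_sum p q = pair_sum q p"
  by (simp add: pair_sum_def mult_ac)

lemma pair_sum_0: "pair_sum p 0 = of_nat (Suc p) * e (Suc p)"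
  using sum_e1[of p] by (simp add: pair_sum_def)

text \<open>Lowering the index of the raised factor by \<open>e1_Suc\<close> leaves the same
  remainder \<open>r\<close>, quadratic in \<open>x i\<close>, on both sides; it cancels.\<close>

lemma pair_sum_Suc:
  "pair_sum p (Suc q) = (of_nat p - of_nat q) * e (Suc p) * e (Suc q) + pair_sum (Suc p) q"
proof -
  define r where "r = (\<Sum>i\<in>C. x i * x i * e1 i p * e1 i q)"
  have "pair_sum p (Suc q) = (\<Sum>i\<in>C. x i * e1 i p * e (Suc q) - x i * x i * e1 i p * e1 i q)"
    unfolding pair_sum_def by (intro sum.cong refl) (simp add: e1_Suc algebra_simps)
  also have "\<dots> = of_nat (Suc p) * e (Suc p) * e (Suc q) - r"
    by (simp only: sum_subtractf r_def sum_e1 flip: sum_distrib_right)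
  finally have 1: "pair_sum p (Suc q) = \<dots>" .
  have "pair_sum (Suc p) q = (\<Sum>i\<in>C. x i * e1 i q * e (Suc p) - x i * x i * e1 i p * e1 i q)"
    unfolding pair_sum_def by (intro sum.cong refl) (simp add: e1_Suc algebra_simps)
  also have "\<dots> = of_nat (Suc q) * e (Suc q) * e (Suc p) - r"
    by (simp only: sum_subtractf r_def sum_e1 flip: sum_distrib_right)
  finally have 2: "pair_sum (Suc p) q = \<dots>" .
  show ?thesis unfolding 1 2 by (simp add: algebra_simps)
qed

lemma triple_sum_0: "triple_sum c y 0 = pair_sum c y"
  by (simp add: triple_sum_def pair_sum_def)

lemma triple_sum_Suc:
  "triple_sum c y (Suc z) =
     pair_sum c y * e (Suc z) - pair_sum c z * e (Suc y) + triple_sum c (Suc y) z"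
proof -
  define r where "r = (\<Sum>i\<in>C. x i * x i * e1 i c * e1 i y * e1 i z)"
  have "triple_sum c y (Suc z) =
      (\<Sum>i\<in>C. x i * e1 i c * e1 i y * e (Suc z) - x i * x i * e1 i c * e1 i y * e1 i z)"
    unfolding triple_sum_def by (intro sum.cong refl) (simp add: e1_Suc algebra_simps)
  also have "\<dots> = pair_sum c y * e (Suc z) - r"
    by (simp only: sum_subtractf r_def pair_sum_def flip: sum_distrib_right)
  finally have 1: "triple_sum c y (Suc z) = \<dots>" .
  have "triple_sum c (Suc y) z =
      (\<Sum>i\<in>C. x i * e1 i c * e1 i z * e (Suc y) - x i * x i * e1 i c * e1 i y * e1 i z)"
    unfolding triple_sum_def by (intro sum.cong refl) (simp add: e1_Suc algebra_simps)
  also have "\<dots> = pair_sum c z * e (Suc y) - r"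
    by (simp only: sum_subtractf r_def pair_sum_def flip: sum_distrib_right)
  finally show ?thesis using 1 by simp
qed

text \<open>The recursion moves \<open>z\<close> into \<open>y\<close> until \<open>z = 0\<close>.
  The negative terms that remain are absorbed later by the coefficients in the expansions of
  \<open>hat_sum\<close>.\<close>

lemma triple_sum_expand:
  "triple_sum c y z =
     (\<Sum>j\<le>z. pair_sum c (y + j) * e (z - j)) - (\<Sum>j<z. pair_sum c (z - Suc j) * e (Suc (y + j)))"
proof (induction z arbitrary: y)
  case 0
  then show ?case by (simp add: triple_sum_0)
next
  case (Suc z)
  show ?case
    unfolding triple_sum_Suc Suc.IH
    by (subst sum.atMost_Suc_shift, subst sum.lessThan_Suc_shift) simp
qed

text \<open>The right-hand side has the shape of the recursion \<open>hat_sum_Suc\<close> without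
  its first term, so the base case fits the expansion towards \<open>l = 0\<close>.\<close>

lemma hat_sum_0_left: "hat_sum 0 b c = of_nat b * e (Suc b) * pair_sum 0 c + triple_sum c (Suc b) 0"
proof -
  have "hat_sum 0 b c = (\<Sum>j\<in>C. x j * e1 j c * (\<Sum>i\<in>C - {j}. x i * e1 i b))"
    by (simp add: hat_sum_def sum_distrib_left mult_ac)
  also have "\<dots> = (\<Sum>j\<in>C. of_nat b * e (Suc b) * (x j * e1 j c) + x j * e1 j c * e1 j (Suc b))"
    by (intro sum.cong refl) (simp add: sum_e1_except algebra_simps)
  also have "\<dots> = of_nat b * e (Suc b) * pair_sum 0 c + triple_sum c (Suc b) 0"
    by (simp add: sum.distrib sum_distrib_left pair_sum_def triple_sum_def)
  finally show ?thesis .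
qed

lemma hat_sum_0_right: "hat_sum l 0 c = of_nat (Suc l) * pair_sum (Suc l) c"
proof -
  have "hat_sum l 0 c = (\<Sum>j\<in>C. x j * e1 j c * (\<Sum>i\<in>C - {j}. x i * e2 j i l))"
    by (simp add: hat_sum_def sum_distrib_left mult_ac)
  also have "\<dots> = of_nat (Suc l) * pair_sum (Suc l) c"
    by (simp only: sum_e2 pair_sum_def sum_distrib_left mult_ac)
  finally show ?thesis .
qed

text \<open>Expanding \<open>e2 j i (Suc l)\<close> on the left and \<open>e1 i (Suc b)\<close> on
  the right produces the same remainder \<open>r\<close>; what is left has inner sums over
  \<open>i\<close> in closed form.\<close>

lemma hat_sum_Suc:
  "hat_sum (Suc l) b c = hat_sum l (Suc b) c
     + (of_nat b - of_nat (Suc l)) * e (Suc b) * pair_sum (Suc l) c + triple_sum c (Suc b) (Suc l)"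
proof -
  define r where "r = (\<Sum>j\<in>C. \<Sum>i\<in>C - {j}. x i * x i * x j * e2 j i l * e1 i b * e1 j c)"
  have "hat_sum (Suc l) b c =
      (\<Sum>j\<in>C. \<Sum>i\<in>C - {j}. x j * e1 j c * e1 j (Suc l) * (x i * e1 i b)
         - x i * x i * x j * e2 j i l * e1 i b * e1 j c)"
    unfolding hat_sum_def by (intro sum.cong refl) (simp add: e2_Suc algebra_simps)
  also have "\<dots> = (\<Sum>j\<in>C. x j * e1 j c * e1 j (Suc l) * (\<Sum>i\<in>C - {j}. x i * e1 i b)) - r"
    by (simp only: sum_subtractf r_def sum_distrib_left)
  also have "(\<Sum>j\<in>C. x j * e1 j c * e1 j (Suc l) * (\<Sum>i\<in>C - {j}. x i * e1 i b))
      = (\<Sum>j\<in>C. of_nat b * e (Suc b) * (x j * e1 j (Suc l) * e1 j c)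
           + x j * e1 j c * e1 j (Suc b) * e1 j (Suc l))"
    by (intro sum.cong refl) (simp add: sum_e1_except algebra_simps)
  also have "\<dots> = of_nat b * e (Suc b) * pair_sum (Suc l) c + triple_sum c (Suc b) (Suc l)"
    by (simp only: sum.distrib pair_sum_def triple_sum_def flip: sum_distrib_left)
  finally have 1: "hat_sum (Suc l) b c = \<dots> - r" .
  have "hat_sum l (Suc b) c =
      (\<Sum>j\<in>C. \<Sum>i\<in>C - {j}. e (Suc b) * (x j * e1 j c) * (x i * e2 j i l)
         - x i * x i * x j * e2 j i l * e1 i b * e1 j c)"
    unfolding hat_sum_def by (intro sum.cong refl) (simp add: e1_Suc algebra_simps)
  also have "\<dots> = (\<Sum>j\<in>C. e (Suc b) * (x j * e1 j c) * (\<Sum>i\<in>C - {j}. x i * e2 j i l)) - r"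
    by (simp only: sum_subtractf r_def sum_distrib_left)
  also have "\<dots> = of_nat (Suc l) * e (Suc b) * pair_sum (Suc l) c - r"
    by (simp only: sum_e2 pair_sum_def sum_distrib_left mult_ac)
  finally have 2: "hat_sum l (Suc b) c = \<dots>" .
  show ?thesis unfolding 1 2 by (simp add: algebra_simps)
qed

text \<open>
  All coefficients of the first expansion are nonnegative if \<open>l \<le> b\<close>, those of the second one
  if \<open>b \<le> l + 1\<close>.
\<close>

lemma hat_sum_expand_left:
  "hat_sum l b c =
     (\<Sum>m\<le>l. (of_nat (b + m) - of_nat l) * e (Suc (b + m)) * pair_sum (l - m) c
            + of_nat (Suc m) * e (l - m) * pair_sum (Suc (b + m)) c)"
proof (induction l arbitrary: b)
  case 0
  then show ?case by (simp add: hat_sum_0_left triple_sum_0 pair_sum_commute)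
next
  case (Suc l)
  \<comment> \<open>After the index shift, the negative terms of the triple sum lower each
    coefficient of the first family by one, and its positive terms raise each coefficient of the
    second family by one.\<close>
  show ?case
    unfolding hat_sum_Suc Suc.IH triple_sum_expand pair_sum_commute[of c]
    by (subst (1 2) sum.atMost_Suc_shift)
      (simp add: lessThan_Suc_atMost sum.distrib sum_subtractf sum_distrib_left algebra_simps)
qed

lemma hat_sum_expand_right:
  "hat_sum l b c =
     (\<Sum>m\<le>b. (of_nat (Suc (l + m)) - of_nat b) * e (b - m) * pair_sum (Suc (l + m)) c)
     + (\<Sum>m<b. of_nat (Suc m) * e (l + m + 2) * pair_sum (b - Suc m) c)"
proof (induction b arbitrary: l)
  case 0
  then show ?case by (simp add: hat_sum_0_right)
next
  case (Suc b)
  \<comment> \<open>The recursion is solved for the larger \<open>b\<close>. The last two arguments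
    of the triple sum are exchanged, so that its expansion runs over \<open>b\<close> and matches
    both families of the claim.\<close>
  have step: "hat_sum l (Suc b) c = hat_sum (Suc l) b c
     - (of_nat b - of_nat (Suc l)) * e (Suc b) * pair_sum (Suc l) c - triple_sum c (Suc l) (Suc b)"
    by (simp add: hat_sum_Suc triple_sum_def mult_ac)
  show ?case
    unfolding step Suc.IH triple_sum_expand pair_sum_commute[of c]
    by (subst (1 2) sum.atMost_Suc_shift, subst (1 2) sum.lessThan_Suc_shift)
      (simp add: sum.distrib sum_subtractf sum_distrib_left algebra_simps)
qed

section \<open>Words that colour paths and hats\<close>

text \<open>These are the d_n of the generating function; the summand \<open>l\<close> comes from
  its term with k = l + 1.\<close>

fun path_coeff :: "nat \<Rightarrow> 'a" where
  "path_coeff 0 = 1"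
| "path_coeff (Suc n) = (\<Sum>l\<le>n. of_nat l * e (Suc l) * path_coeff (n - l))"

definition weight :: "'i list \<Rightarrow> 'a" where
  "weight xs = prod_list (map x xs)"

lemma weight_simps [simp]:
  "weight [] = 1" "weight (i # xs) = x i * weight xs" "weight (xs @ ys) = weight xs * weight ys"
  "weight (rev xs) = weight xs"
  by (simp_all add: weight_def rev_map) (induction xs; simp add: mult.commute)

definition words :: "nat \<Rightarrow> 'i list set" where
  "words k = {xs. set xs \<subseteq> C \<and> length xs = k}"

lemma finite_words [simp]: "finite (words k)"
  unfolding words_def using finite_lists_length_eq[OF finite_C] .

definition walks :: "nat \<Rightarrow> 'i \<Rightarrow> 'i list set" where
  "walks k i = {xs \<in> words k. successively (\<noteq>) (i # xs)}"

definition bridges :: "nat \<Rightarrow> 'i \<Rightarrow> 'i \<Rightarrow> 'i list set" where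
  "bridges k i j = {xs \<in> words k. successively (\<noteq>) (i # xs @ [j])}"

text \<open>Here \<open>k = m - 2\<close> counts the vertices strictly between the ends of the added
  edge. Positions start at 0, so these ends sit at \<open>a\<close> and
  \<open>a + k + 1\<close>.\<close>

definition hat_words :: "nat \<Rightarrow> nat \<Rightarrow> nat \<Rightarrow> 'i list set" where
  "hat_words a k b =
     {xs \<in> words (a + k + b + 2). successively (\<noteq>) xs \<and> xs ! a \<noteq> xs ! (a + k + 1)}"

lemma finite_walks [simp]: "finite (walks k i)" "finite (bridges k i j)" "finite (hat_words a k b)"
  by (simp_all add: walks_def bridges_def hat_words_def)

lemma walk_weight_0: "sum weight (walks 0 i) = 1"
proof -
  have "walks 0 i = {[]}" by (auto simp: walks_def words_def)
  then show ?thesis by simp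
qed

lemma walk_weight_Suc: "sum weight (walks (Suc k) i) = (\<Sum>j\<in>C - {i}. x j * sum weight (walks k j))"
proof -
  have "sum weight (walks (Suc k) i) =
      (\<Sum>(j, xs)\<in>(SIGMA j:C - {i}. walks k j). x j * weight xs)"
    by (rule sum.reindex_bij_witness[of _ "\<lambda>(j, xs). j # xs" "\<lambda>xs. (hd xs, tl xs)"])
       (auto simp: walks_def words_def length_Suc_conv)
  then show ?thesis
    using finite_C by (simp add: sum.Sigma sum_distrib_left)
qed

lemma walk_weight:
  "i \<in> C \<Longrightarrow> sum weight (walks k i) = (\<Sum>l\<le>k. path_coeff (k - l) * e1 i l)"
proof (induction k arbitrary: i)
  case 0
  then show ?case by (simp add: walk_weight_0)
next
  case (Suc k)
  have "sum weight (walks (Suc k) i)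
      = (\<Sum>j\<in>C - {i}. \<Sum>l\<le>k. path_coeff (k - l) * (x j * e1 j l))"
    by (simp add: walk_weight_Suc Suc.IH sum_distrib_left mult_ac)
  also have "\<dots> = (\<Sum>l\<le>k. path_coeff (k - l) * (\<Sum>j\<in>C - {i}. x j * e1 j l))"
    by (subst sum.swap) (simp add: sum_distrib_left)
  \<comment> \<open>The parts \<open>of_nat l * e (Suc l)\<close> add up to the recursion for
    \<open>path_coeff (Suc k)\<close>, which is the term \<open>l = 0\<close> of the goal.\<close>
  also have "\<dots> = path_coeff (Suc k) + (\<Sum>l\<le>k. path_coeff (k - l) * e1 i (Suc l))"
    using Suc.prems by (simp add: sum_e1_except algebra_simps sum.distrib)
  also have "\<dots> = (\<Sum>l\<le>Suc k. path_coeff (Suc k - l) * e1 i l)"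
    by (subst sum.atMost_Suc_shift) simp
  finally show ?case .
qed

lemma bridge_weight_0: "i \<noteq> j \<Longrightarrow> sum weight (bridges 0 i j) = 1"
proof -
  assume "i \<noteq> j"
  then have "bridges 0 i j = {[]}" by (auto simp: bridges_def words_def)
  then show ?thesis by simp
qed

text \<open>A walk from \<open>i\<close> either avoids \<open>j\<close> as its last letter and is a
  bridge, or it ends in \<open>j\<close> and the letters before form a shorter bridge.\<close>

lemma bridge_weight_Suc:
  assumes "j \<in> C"
  shows "sum weight (bridges (Suc k) i j) =
           sum weight (walks (Suc k) i) - x j * sum weight (bridges k i j)"
proof -
  have "walks (Suc k) i = bridges (Suc k) i j \<union> (\<lambda>xs. xs @ [j]) ` bridges k i j" (is "?L = ?R")
  proof (intro equalityI subsetI)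
    fix xs assume xs: "xs \<in> ?L"
    then obtain ys c where "xs = ys @ [c]"
      by (cases xs rule: rev_cases) (auto simp: walks_def words_def)
    then show "xs \<in> ?R"
      using xs successively_append_iff[of "(\<noteq>)" "i # ys @ [c]" "[j]"]
      by (cases "c = j") (auto simp: walks_def bridges_def words_def)
  next
    fix xs assume "xs \<in> ?R"
    then show "xs \<in> ?L"
      using assms successively_append_iff[of "(\<noteq>)" "i # xs" "[j]"]
      by (auto simp: walks_def bridges_def words_def)
  qed
  moreover have "bridges (Suc k) i j \<inter> (\<lambda>xs. xs @ [j]) ` bridges k i j = {}"
    by (auto simp: bridges_def successively_append_iff successively_Cons)
  ultimately have "sum weight (walks (Suc k) i) =
      sum weight (bridges (Suc k) i j) + sum weight ((\<lambda>xs. xs @ [j]) ` bridges k i j)"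
    by (simp add: sum.union_disjoint)
  also have "sum weight ((\<lambda>xs. xs @ [j]) ` bridges k i j) = x j * sum weight (bridges k i j)"
    by (subst sum.reindex) (auto simp: inj_on_def sum_distrib_left mult_ac)
  finally show ?thesis by simp
qed

lemma bridge_weight:
  assumes "i \<in> C" "j \<in> C - {i}"
  shows "sum weight (bridges k i j) = (\<Sum>l\<le>k. path_coeff (k - l) * e2 i j l)"
proof (induction k)
  case 0
  then show ?case using assms bridge_weight_0[of i j] by auto
next
  case (Suc k)
  \<comment> \<open>By \<open>e2_Suc\<close>, the claimed sums obey the same recursion as the bridge
    weights.\<close>
  have "(\<Sum>l\<le>Suc k. path_coeff (Suc k - l) * e1 i l)
      = (\<Sum>l\<le>Suc k. path_coeff (Suc k - l) * e2 i j l)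
        + x j * (\<Sum>l\<le>k. path_coeff (k - l) * e2 i j l)"
    using assms by (subst (1 2) sum.atMost_Suc_shift)
      (simp add: e2_Suc sum.distrib sum_subtractf sum_distrib_left algebra_simps)
  then show ?case
    using assms by (simp add: bridge_weight_Suc Suc.IH walk_weight algebra_simps del: sum.atMost_Suc)
qed

lemma e2_commute: "e2 i j = e2 j i"
  by (simp add: Diff_insert2[symmetric] insert_commute)

text \<open>The left part is reversed so that it becomes a walk starting next to \<open>i\<close>;
  the added edge turns into \<open>i \<noteq> j\<close>.\<close>

lemma hat_words_append_iff:
  assumes "length as = a" "length ms = k" "length bs = b"
  shows "rev as @ i # ms @ j # bs \<in> hat_words a k b \<longleftrightarrow>
           j \<in> C \<and> i \<in> C - {j} \<and> as \<in> walks a i \<and> ms \<in> bridges k i j \<and> bs \<in> walks b j"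
proof -
  have "successively (\<noteq>) (rev as @ i # ms @ j # bs) \<longleftrightarrow>
      successively (\<noteq>) (rev (i # as)) \<and> successively (\<noteq>) (i # ms @ [j]) \<and> successively (\<noteq>) (j # bs)"
    using successively_append_Cons[of "(\<noteq>)" "rev as" i "ms @ j # bs"]
      successively_append_Cons[of "(\<noteq>)" "i # ms" j bs] by simp
  also have "successively (\<noteq>) (rev (i # as)) \<longleftrightarrow> successively (\<noteq>) (i # as)"
    unfolding successively_rev by (rule successively_cong) auto
  finally show ?thesis
    using assms by (auto simp: hat_words_def walks_def bridges_def words_def nth_append)
qed

lemma hat_weight_split:
  "sum weight (hat_words a k b) =
     (\<Sum>j\<in>C. \<Sum>i\<in>C - {j}. \<Sum>as\<in>walks a i. \<Sum>ms\<in>bridges k i j. \<Sum>bs\<in>walks b j.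
        x i * x j * weight as * weight ms * weight bs)"
proof -
  \<comment> \<open>The colours of the ends come first because the sets of the three words depend on
    them.\<close>
  let ?cut = "\<lambda>xs. (xs ! (a + k + 1), xs ! a, rev (take a xs), take k (drop (a + 1) xs), drop (a + k + 2) xs)"
  let ?S = "SIGMA j:C. SIGMA i:C - {j}. walks a i \<times> bridges k i j \<times> walks b j"
  have len: "length as = a \<and> length ms = k \<and> length bs = b" if "(j, i, as, ms, bs) \<in> ?S" for j i as ms bs
    using that by (auto simp: walks_def bridges_def words_def)
  have join: "take a xs @ xs ! a # take k (drop (a + 1) xs) @ xs ! (a + k + 1) # drop (a + k + 2) xs = xs"
    and lens: "length (rev (take a xs)) = a" "length (take k (drop (a + 1) xs)) = k"
      "length (drop (a + k + 2) xs) = b"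
    if "xs \<in> hat_words a k b" for xs
  proof -
    have l: "length xs = a + k + b + 2"
      using that by (simp add: hat_words_def words_def)
    have "take k (drop (a + 1) xs) @ xs ! (a + k + 1) # drop (a + k + 2) xs = drop (a + 1) xs"
      using l id_take_nth_drop[of k "drop (a + 1) xs"] by (simp add: add_ac)
    then show "take a xs @ xs ! a # take k (drop (a + 1) xs) @ xs ! (a + k + 1) # drop (a + k + 2) xs = xs"
      using l id_take_nth_drop[of a xs] by simp
    show "length (rev (take a xs)) = a" "length (take k (drop (a + 1) xs)) = k"
      "length (drop (a + k + 2) xs) = b" using l by simp_all
  qed
  have "sum weight (hat_words a k b) =
      (\<Sum>(j, i, as, ms, bs)\<in>?S. x i * x j * weight as * weight ms * weight bs)"
  proof (rule sum.reindex_bij_witness[of _ "\<lambda>(j, i, as, ms, bs). rev as @ i # ms @ j # bs" ?cut])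
    fix xs assume xs: "xs \<in> hat_words a k b"
    show "(case ?cut xs of (j, i, as, ms, bs) \<Rightarrow> rev as @ i # ms @ j # bs) = xs"
      using join[OF xs] by simp
    show "?cut xs \<in> ?S"
      using hat_words_append_iff[OF lens[OF xs], of "xs ! a" "xs ! (a + k + 1)"] join[OF xs] xs by simp
    have "weight xs = weight (take a xs @ xs ! a # take k (drop (a + 1) xs) @ xs ! (a + k + 1)
        # drop (a + k + 2) xs)"
      using join[OF xs] by simp
    then show "(case ?cut xs of (j, i, as, ms, bs) \<Rightarrow> x i * x j * weight as * weight ms * weight bs)
        = weight xs" by (simp add: mult_ac)
  next
    fix y assume y: "y \<in> ?S"
    obtain j i as ms bs where [simp]: "y = (j, i, as, ms, bs)" by (cases y)
    from y len have [simp]: "length as = a" "length ms = k" "length bs = b" by auto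
    show "?cut (case y of (j, i, as, ms, bs) \<Rightarrow> rev as @ i # ms @ j # bs) = y"
      by (simp add: nth_append)
    show "(case y of (j, i, as, ms, bs) \<Rightarrow> rev as @ i # ms @ j # bs) \<in> hat_words a k b"
      using y by (simp add: hat_words_append_iff)
  qed
  then show ?thesis
    using finite_C by (simp add: sum.Sigma sum.cartesian_product)
qed

lemma hat_weight:
  "sum weight (hat_words a k b) =
     (\<Sum>p\<le>a. \<Sum>l\<le>k. \<Sum>q\<le>b.
        path_coeff (a - p) * path_coeff (k - l) * path_coeff (b - q) * hat_sum l p q)"
proof -
  let ?d = "\<lambda>p l q. path_coeff (a - p) * path_coeff (k - l) * path_coeff (b - q)"
  have "sum weight (hat_words a k b) = (\<Sum>j\<in>C. \<Sum>i\<in>C - {j}. x i * x j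
       * sum weight (walks a i) * sum weight (bridges k i j) * sum weight (walks b j))"
    unfolding hat_weight_split by (simp add: sum_distrib_left sum_distrib_right mult_ac)
  also have "\<dots> = (\<Sum>j\<in>C. \<Sum>i\<in>C - {j}. x i * x j
       * (\<Sum>p\<le>a. path_coeff (a - p) * e1 i p) * (\<Sum>l\<le>k. path_coeff (k - l) * e2 j i l)
       * (\<Sum>q\<le>b. path_coeff (b - q) * e1 j q))"
    by (intro sum.cong refl) (auto simp: walk_weight bridge_weight e2_commute)
  also have "\<dots> = (\<Sum>j\<in>C. \<Sum>i\<in>C - {j}. \<Sum>p\<le>a. \<Sum>l\<le>k. \<Sum>q\<le>b.
       ?d p l q * (x i * x j * e2 j i l * e1 i p * e1 j q))"
    by (simp add: sum_distrib_left sum_distrib_right mult_ac)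
  also have "\<dots> = (\<Sum>p\<le>a. \<Sum>j\<in>C. \<Sum>i\<in>C - {j}. \<Sum>l\<le>k. \<Sum>q\<le>b.
       ?d p l q * (x i * x j * e2 j i l * e1 i p * e1 j q))"
    by (simp add: sum.swap[of _ "{..a}"])
  also have "\<dots> = (\<Sum>p\<le>a. \<Sum>l\<le>k. \<Sum>j\<in>C. \<Sum>i\<in>C - {j}. \<Sum>q\<le>b.
       ?d p l q * (x i * x j * e2 j i l * e1 i p * e1 j q))"
    by (simp add: sum.swap[of _ "{..k}"])
  also have "\<dots> = (\<Sum>p\<le>a. \<Sum>l\<le>k. \<Sum>q\<le>b. \<Sum>j\<in>C. \<Sum>i\<in>C - {j}.
       ?d p l q * (x i * x j * e2 j i l * e1 i p * e1 j q))"
    by (simp add: sum.swap[of _ "{..b}"])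
  also have "\<dots> = (\<Sum>p\<le>a. \<Sum>l\<le>k. \<Sum>q\<le>b. ?d p l q * hat_sum l p q)"
    by (simp add: hat_sum_def sum_distrib_left)
  finally show ?thesis .
qed

end

section \<open>Positive expansions\<close>

text \<open>Monomials are multisets of indices, as in \<open>series\<close>, so coefficients of
  polynomials and series can be compared directly.\<close>

abbreviation var :: "nat \<Rightarrow> nat multiset \<Rightarrow>\<^sub>0 rat" where
  "var i \<equiv> Poly_Mapping.single {#i#} 1"

interpretation vars: alphabet "{0<..N}" var for N :: nat
  by unfold_locales simp

text \<open>
  An \<open>e\<close>-expansion must not depend on the number \<open>N\<close> of variables, so positivity is a property of a
  whole family of polynomials indexed by \<open>N\<close>.
\<close>

inductive epos :: "(nat \<Rightarrow> nat multiset \<Rightarrow>\<^sub>0 rat) \<Rightarrow> bool" where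
  epos_0: "epos (\<lambda>N. 0)"
| epos_step: "epos f \<Longrightarrow> epos (\<lambda>N. (\<Prod>k\<in>#\<mu>. vars.e N k) + f N)"

lemma epos_add: "epos f \<Longrightarrow> epos g \<Longrightarrow> epos (\<lambda>N. f N + g N)"
  by (induction rule: epos.induct) (simp_all add: add.assoc epos_step)

lemma epos_prod_e: "epos (\<lambda>N. \<Prod>k\<in>#\<mu>. vars.e N k)"
  using epos_step[OF epos_0, of \<mu>] by simp

lemma epos_e: "epos (\<lambda>N. vars.e N k)"
  using epos_prod_e[of "{#k#}"] by simp

lemma epos_1: "epos (\<lambda>N. 1)"
  using epos_prod_e[of "{#}"] by simp

lemma epos_prod_e_mult: "epos g \<Longrightarrow> epos (\<lambda>N. (\<Prod>k\<in>#\<mu>. vars.e N k) * g N)"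
proof (induction rule: epos.induct)
  case epos_0
  then show ?case by (simp add: epos.epos_0)
next
  case (epos_step f \<nu>)
  then show ?case
    using epos.epos_step[OF epos_step.IH, of "\<mu> + \<nu>"] by (simp add: algebra_simps)
qed

lemma epos_mult: "epos f \<Longrightarrow> epos g \<Longrightarrow> epos (\<lambda>N. f N * g N)"
proof (induction rule: epos.induct)
  case epos_0
  then show ?case by (simp add: epos.epos_0)
next
  case (epos_step f \<mu>)
  then show ?case
    using epos_add[OF epos_prod_e_mult[of g \<mu>]] by (simp add: algebra_simps)
qed

lemma epos_of_nat: "epos (\<lambda>N. of_nat n)"
  by (induction n) (simp_all add: epos_0 epos_add epos_1)

lemma epos_sum: "(\<And>i. i \<in> A \<Longrightarrow> epos (f i)) \<Longrightarrow> epos (\<lambda>N. \<Sum>i\<in>A. f i N)"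
  by (induction A rule: infinite_finite_induct) (simp_all add: epos_0 epos_add)

lemma epos_of_nat_diff: "n \<le> m \<Longrightarrow> epos (\<lambda>N. of_nat m - of_nat n)"
  using epos_of_nat[of "m - n"] by (simp add: of_nat_diff)

lemmas epos_intros = epos_add epos_mult epos_sum epos_of_nat_diff epos_of_nat epos_e

text \<open>For \<open>q \<le> p\<close> the recursion down to \<open>q = 0\<close> widens the gap
  between the indices, so every coefficient is nonnegative; symmetry gives the other case.\<close>

lemma epos_pair_sum: "epos (\<lambda>N. vars.pair_sum N p q)"
proof -
  have le: "epos (\<lambda>N. vars.pair_sum N p q)" if "q \<le> p" for p q
    using that
  proof (induction q arbitrary: p)
    case 0
    show ?case unfolding vars.pair_sum_0 by (intro epos_intros)
  next
    case (Suc q)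
    then show ?case
      unfolding vars.pair_sum_Suc by (intro epos_intros) auto
  qed
  show ?thesis
  proof (cases "q \<le> p")
    case False
    then show ?thesis using le[of p q] vars.pair_sum_commute[of _ p q] by simp
  qed (rule le)
qed

lemma epos_hat_sum: "epos (\<lambda>N. vars.hat_sum N l b c)"
proof (cases "l \<le> b")
  case True
  then show ?thesis
    unfolding vars.hat_sum_expand_left by (intro epos_intros epos_pair_sum) auto
next
  case False
  then show ?thesis
    unfolding vars.hat_sum_expand_right by (intro epos_intros epos_pair_sum) auto
qed

lemma epos_path_coeff: "epos (\<lambda>N. vars.path_coeff N n)"
proof (induction n rule: less_induct)
  case (less n)
  show ?case
  proof (cases n)
    case (Suc k)
    then show ?thesis
      using less.IH by (auto intro!: epos_intros)
  qed (simp add: epos_1)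
qed

lemma epos_hat_weight: "epos (\<lambda>N. sum vars.weight (vars.hat_words N a k b))"
  unfolding vars.hat_weight by (intro epos_intros epos_path_coeff epos_hat_sum)

section \<open>From polynomials in N variables to formal series\<close>

lemma finite_submultisets: "finite {A. A \<subseteq># M}"
proof (rule finite_subset)
  show "{A. A \<subseteq># M} \<subseteq> mset ` {xs. set xs \<subseteq> set_mset M \<and> length xs \<le> size M}"
  proof
    fix A assume "A \<in> {A. A \<subseteq># M}"
    moreover obtain xs where "A = mset xs" using ex_mset by metis
    ultimately show "A \<in> mset ` {xs. set xs \<subseteq> set_mset M \<and> length xs \<le> size M}"
      using set_mset_mono[of A M] size_mset_mono[of A M] by auto
  qed
qed (simp add: finite_lists_length_le)

text \<open>Factorizations of the monomial \<open>M\<close> correspond to its submultisets, so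
  polynomial multiplication agrees with \<open>series_mult\<close>.\<close>

lemma lookup_mult_multiset:
  fixes p q :: "'b multiset \<Rightarrow>\<^sub>0 'c::comm_semiring_0"
  shows "Poly_Mapping.lookup (p * q) M =
           (\<Sum>A | A \<subseteq># M. Poly_Mapping.lookup p A * Poly_Mapping.lookup q (M - A))"
proof -
  have "(\<Sum>B. Poly_Mapping.lookup q B when M = A + B)
      = (Poly_Mapping.lookup q (M - A) when A \<subseteq># M)" for A
  proof (cases "A \<subseteq># M")
    case True
    then have "M = A + B \<longleftrightarrow> B = M - A" for B
      by auto
    then show ?thesis using True by simp
  next
    case False
    then have "M \<noteq> A + B" for B by auto
    then show ?thesis using False by simp
  qed
  then have "Poly_Mapping.lookup (p * q) M =
      (\<Sum>A. Poly_Mapping.lookup p A * (Poly_Mapping.lookup q (M - A) when A \<subseteq># M))"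
    by (simp add: lookup_mult)
  also have "\<dots> = (\<Sum>A | A \<subseteq># M. Poly_Mapping.lookup p A * (Poly_Mapping.lookup q (M - A) when A \<subseteq># M))"
    by (rule Sum_any.expand_superset) (auto simp: finite_submultisets when_def)
  finally show ?thesis by simp
qed

lemma prod_var: "finite S \<Longrightarrow> (\<Prod>i\<in>S. var i) = Poly_Mapping.single (mset_set S) 1"
  by (induction rule: finite_induct) (simp_all add: mult_single single_one)

lemma sum_lookup_single:
  assumes "finite A"
  shows "(\<Sum>a\<in>A. Poly_Mapping.lookup (Poly_Mapping.single (h a) 1) M) = (of_nat (card {a \<in> A. h a = M}) :: rat)"
  using assms by (simp add: lookup_single when_def sum.If_cases Int_def)

text \<open>An admissible \<open>S\<close> with \<open>mset_set S = M\<close> is the support of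
  \<open>M\<close> and hence lies in \<open>{0<..N}\<close>: the cut to N variables loses nothing at
  \<open>M\<close>.\<close>

lemma lookup_e:
  assumes "set_mset M \<subseteq> {..N}"
  shows "Poly_Mapping.lookup (vars.e N k) M = elem_sym k M"
proof -
  have "Poly_Mapping.lookup (vars.e N k) M =
      (\<Sum>S | S \<subseteq> {0<..N} \<and> card S = k. Poly_Mapping.lookup (Poly_Mapping.single (mset_set S) 1) M)"
    unfolding esym_def lookup_sum by (intro sum.cong refl) (auto simp: prod_var finite_subset)
  also have "\<dots> = of_nat (card {S \<in> {S. S \<subseteq> {0<..N} \<and> card S = k}. mset_set S = M})"
    by (rule sum_lookup_single) simp
  also have "{S \<in> {S. S \<subseteq> {0<..N} \<and> card S = k}. mset_set S = M} =
      {S. S \<subseteq> {1..} \<and> finite S \<and> card S = k \<and> mset_set S = M}"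
    using assms by (fastforce dest: finite_subset)
  finally show ?thesis by (simp add: elem_sym_def)
qed

lemma lookup_prod_list_e:
  assumes "set_mset M \<subseteq> {..N}"
  shows "Poly_Mapping.lookup (\<Prod>k\<leftarrow>la. vars.e N k) M = elem_sym_partition la M"
  using assms
proof (induction la arbitrary: M)
  case Nil
  then show ?case
    by (auto simp: elem_sym_partition_def series_one_def lookup_one when_def)
next
  case (Cons k la)
  have "Poly_Mapping.lookup (\<Prod>k\<leftarrow>k # la. vars.e N k) M =
      (\<Sum>A | A \<subseteq># M. elem_sym k A * elem_sym_partition la (M - A))"
    unfolding list.map prod_list.Cons lookup_mult_multiset
  proof (intro sum.cong refl)
    fix A assume "A \<in> {A. A \<subseteq># M}"
    then have "set_mset A \<subseteq> {..N}" "set_mset (M - A) \<subseteq> {..N}"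
      using Cons.prems by (auto dest: mset_subset_eqD in_diffD)
    then show "Poly_Mapping.lookup (vars.e N k) A * Poly_Mapping.lookup (\<Prod>k\<leftarrow>la. vars.e N k) (M - A)
        = elem_sym k A * elem_sym_partition la (M - A)"
      by (simp only: lookup_e Cons.IH)
  qed
  then show ?case by (simp add: elem_sym_partition_def series_mult_def)
qed

text \<open>Sorting the factors and deleting zero indices does not change the product, since e_0 =
  1.\<close>

lemma ex_partition_prod_e:
  "\<exists>la. is_partition la \<and> (\<forall>N. (\<Prod>k\<in>#\<mu>. vars.e N k) = (\<Prod>k\<leftarrow>la. vars.e N k))"
proof -
  define la where "la = rev (sorted_list_of_multiset (filter_mset (\<lambda>k. 0 < k) \<mu>))"
  have "is_partition la"
    by (simp add: is_partition_def la_def sorted_wrt_rev)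
  moreover have "(\<Prod>k\<in>#\<mu>. vars.e N k) = (\<Prod>k\<leftarrow>la. vars.e N k)" for N
  proof -
    have "(\<Prod>k\<leftarrow>la. vars.e N k) = (\<Prod>k\<in>#mset la. vars.e N k)"
      by (simp add: prod_mset_prod_list flip: mset_map)
    also have "mset la = filter_mset (\<lambda>k. 0 < k) \<mu>"
      by (simp add: la_def)
    also have "(\<Prod>k\<in>#\<dots>. vars.e N k) = (\<Prod>k\<in>#\<mu>. vars.e N k)"
      by (induction \<mu>) auto
    finally show ?thesis by simp
  qed
  ultimately show ?thesis by blast
qed

text \<open>One expansion serves all N, and each single \<open>M\<close> is reached by an N that
  bounds its indices.\<close>

lemma epos_imp_e_positive_series:
  assumes "epos f" and "\<And>M N. set_mset M \<subseteq> {..N} \<Longrightarrow> g M = Poly_Mapping.lookup (f N) M"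
  shows "e_positive_series g"
proof -
  have "\<exists>P c. finite P \<and> (\<forall>la\<in>P. is_partition la \<and> (0::rat) \<le> c la) \<and>
      (\<forall>M N. set_mset M \<subseteq> {..N} \<longrightarrow>
         Poly_Mapping.lookup (f N) M = (\<Sum>la\<in>P. c la * elem_sym_partition la M))"
    using assms(1)
  proof (induction rule: epos.induct)
    case epos_0
    show ?case by (intro exI[of _ "{}"]) simp
  next
    case (epos_step f \<mu>)
    then obtain P and c :: "nat list \<Rightarrow> rat" where P: "finite P" "\<forall>la\<in>P. is_partition la \<and> 0 \<le> c la"
      and f: "\<And>M N. set_mset M \<subseteq> {..N} \<Longrightarrow>
         Poly_Mapping.lookup (f N) M = (\<Sum>la\<in>P. c la * elem_sym_partition la M)"
      by auto
    obtain ka where ka: "is_partition ka" "\<And>N. (\<Prod>k\<in>#\<mu>. vars.e N k) = (\<Prod>k\<leftarrow>ka. vars.e N k)"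
      using ex_partition_prod_e by blast
    \<comment> \<open>If \<open>ka\<close> already lies in \<open>P\<close>, its coefficient grows
      by one; values of \<open>c\<close> outside \<open>P\<close> are unknown and replaced by
      0.\<close>
    let ?c = "\<lambda>la. (if la = ka then 1 else 0) + (if la \<in> P then c la else 0)"
    have "Poly_Mapping.lookup ((\<Prod>k\<in>#\<mu>. vars.e N k) + f N) M
        = (\<Sum>la\<in>insert ka P. ?c la * elem_sym_partition la M)"
      if M: "set_mset M \<subseteq> {..N}" for M N
    proof -
      have "(\<Sum>la\<in>insert ka P. ?c la * elem_sym_partition la M)
          = (\<Sum>la\<in>insert ka P. if la = ka then elem_sym_partition la M else 0)
            + (\<Sum>la\<in>insert ka P. if la \<in> P then c la * elem_sym_partition la M else 0)"
        unfolding sum.distrib[symmetric] by (intro sum.cong refl) (auto simp: algebra_simps)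
      also have "(\<Sum>la\<in>insert ka P. if la = ka then elem_sym_partition la M else 0)
          = elem_sym_partition ka M"
        using P(1) by simp
      also have "(\<Sum>la\<in>insert ka P. if la \<in> P then c la * elem_sym_partition la M else 0)
          = (\<Sum>la\<in>P. c la * elem_sym_partition la M)"
        using P(1) by (intro sum.mono_neutral_cong_right) auto
      finally show ?thesis
        using M by (simp add: lookup_add ka(2) f lookup_prod_list_e)
    qed
    then show ?case
      using P ka(1) by (intro exI[of _ "insert ka P"] exI[of _ ?c]) auto
  qed
  then obtain P and c :: "nat list \<Rightarrow> rat" where P: "finite P" "\<forall>la\<in>P. is_partition la \<and> 0 \<le> c la"
    and f: "\<And>M N. set_mset M \<subseteq> {..N} \<Longrightarrow>
       Poly_Mapping.lookup (f N) M = (\<Sum>la\<in>P. c la * elem_sym_partition la M)"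
    by auto
  have "g M = (\<Sum>la\<in>P. c la * elem_sym_partition la M)" for M
  proof -
    obtain N where "set_mset M \<subseteq> {..N}"
      using finite_nat_set_iff_bounded_le[of "set_mset M"] by auto
    then show ?thesis using assms(2) f by simp
  qed
  then show ?thesis
    unfolding e_positive_series_def using P by blast
qed

section \<open>Proper colourings of the hat as words\<close>

lemma weight_var: "vars.weight xs = Poly_Mapping.single (mset xs) 1"
  by (induction xs) (simp_all add: mult_single single_one)

lemma proper_colorings_hat:
  "\<kappa> \<in> proper_colorings (hat a m b) \<longleftrightarrow>
     \<kappa> \<in> {1..a + m + b} \<rightarrow>\<^sub>E {1..} \<and> (\<forall>i. 1 \<le> i \<and> i < a + m + b \<longrightarrow> \<kappa> i \<noteq> \<kappa> (i + 1))
       \<and> \<kappa> (a + 1) \<noteq> \<kappa> (a + m)"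
  unfolding proper_colorings_def hat_def by (auto simp: doubleton_eq_iff) 

text \<open>Reading the colours along the path turns colourings with content \<open>M\<close> into
  hat words with content \<open>M\<close>.\<close>

lemma chromatic_sym_hat:
  assumes "set_mset M \<subseteq> {..N}"
  shows "chromatic_sym (hat a (k + 2) b) M =
           Poly_Mapping.lookup (sum vars.weight (vars.hat_words N a k b)) M"
proof -
  define n where "n = a + k + b + 2"
  let ?K = "{\<kappa> \<in> proper_colorings (hat a (k + 2) b). image_mset \<kappa> (mset_set {1..n}) = M}"
  let ?W = "{xs \<in> vars.hat_words N a k b. mset xs = M}"
  have "bij_betw (\<lambda>\<kappa>. map \<kappa> [1..<Suc n]) ?K ?W"
  \<comment> \<open>Vertex \<open>v\<close> carries letter \<open>v - 1\<close>; the restriction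
    makes the inverse image extensional.\<close>
  proof (rule bij_betw_byWitness[where f' = "\<lambda>xs. \<lambda>v\<in>{1..n}. xs ! (v - 1)"])
    show "\<forall>\<kappa>\<in>?K. (\<lambda>v\<in>{1..n}. map \<kappa> [1..<Suc n] ! (v - 1)) = \<kappa>"
    proof
      fix \<kappa> assume "\<kappa> \<in> ?K"
      then have "\<kappa> \<in> extensional {1..n}"
        by (auto simp: proper_colorings_hat n_def PiE_def add_ac)
      then show "(\<lambda>v\<in>{1..n}. map \<kappa> [1..<Suc n] ! (v - 1)) = \<kappa>"
        by (intro extensionalityI[of _ "{1..n}"]) (auto simp: nth_append less_Suc_eq_le simp del: upt_Suc)
    qed
    show inv: "\<forall>xs\<in>?W. map (\<lambda>v\<in>{1..n}. xs ! (v - 1)) [1..<Suc n] = xs"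
      by (auto intro!: nth_equalityI simp: vars.hat_words_def vars.words_def n_def simp del: upt_Suc)
    show "(\<lambda>\<kappa>. map \<kappa> [1..<Suc n]) ` ?K \<subseteq> ?W"
    proof clarify
      fix \<kappa> assume \<kappa>: "\<kappa> \<in> proper_colorings (hat a (k + 2) b)"
        and M: "M = image_mset \<kappa> (mset_set {1..n})"
      \<comment> \<open>Every colour used occurs in \<open>M\<close> and is therefore at most
        \<open>N\<close>.\<close>
      have fin: "\<kappa> ` {1..n} \<subseteq> {0<..N}"
        using \<kappa> assms by (auto simp: proper_colorings_hat M n_def PiE_def Pi_def add_ac Suc_le_eq)
      have "map \<kappa> [1..<Suc n] \<in> vars.hat_words N a k b"
        using \<kappa> fin
        by (auto simp: vars.hat_words_def vars.words_def proper_colorings_hat n_def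
            successively_conv_nth add_ac simp del: upt_Suc)
      then show "map \<kappa> [1..<Suc n] \<in> vars.hat_words N a k b \<and>
          mset (map \<kappa> [1..<Suc n]) = image_mset \<kappa> (mset_set {1..n})"
        by (simp add: atLeastLessThanSuc_atLeastAtMost del: upt_Suc)
    qed
    show "(\<lambda>xs. \<lambda>v\<in>{1..n}. xs ! (v - 1)) ` ?W \<subseteq> ?K"
    proof (rule image_subsetI)
      fix xs assume xs: "xs \<in> ?W"
      let ?\<kappa> = "\<lambda>v\<in>{1..n}. xs ! (v - 1)"
      have l: "length xs = n" and C: "set xs \<subseteq> {0<..N}" and "mset xs = M"
        using xs by (auto simp: vars.hat_words_def vars.words_def n_def)
      have "map ?\<kappa> [1..<Suc n] = xs" using inv xs by blast
      then have "image_mset ?\<kappa> (mset_set {1..n}) = M"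
        using \<open>mset xs = M\<close> by (metis mset_map mset_upt atLeastLessThanSuc_atLeastAtMost)
      moreover have "?\<kappa> \<in> {1..n} \<rightarrow>\<^sub>E {1..}"
        using C l by (force simp: Suc_le_eq subset_iff)
      moreover have "?\<kappa> i \<noteq> ?\<kappa> (i + 1)" if "1 \<le> i" "i < n" for i
        using xs that l successively_nth[of "(\<noteq>)" xs "i - 1"] by (auto simp: vars.hat_words_def)
      moreover have "?\<kappa> (a + 1) \<noteq> ?\<kappa> (a + (k + 2))"
        using xs by (auto simp: vars.hat_words_def n_def)
      ultimately show "?\<kappa> \<in> ?K"
        by (simp add: proper_colorings_hat n_def add_ac)
    qed
  qed
  then have "card ?K = card ?W" by (rule bij_betw_same_card)
  moreover have "Poly_Mapping.lookup (sum vars.weight (vars.hat_words N a k b)) M = of_nat (card ?W)"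
    by (simp add: lookup_sum weight_var sum_lookup_single)
  moreover have "fst (hat a (k + 2) b) = {1..n}"
    by (simp add: hat_def n_def add_ac)
  ultimately show ?thesis
    by (simp add: chromatic_sym_def)
qed

theorem theorem3p9:
  fixes a m b :: nat
  assumes "m \<ge> 2"
  shows "e_positive (hat a m b)"
proof -
  obtain k where "m = k + 2"
    using assms by (metis add.commute le_Suc_ex)
  then show ?thesis
    unfolding e_positive_def
    using epos_imp_e_positive_series[OF epos_hat_weight chromatic_sym_hat] by blast
qed

end
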